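(* Let $(X,\mathcal{B},\mu)$ be a standard probability space and let $T:X\to X$ be a Borel $\mu$-measure-preserving transformation. For $f\in L^1(X,\mathcal{B},\mu)$ define, for each $x\in X$, $$f^\star(x)=\sup_{E_x\in\mathrm{CT}_x}A_{f,E_x}.$$ Then for every $f\in L^1(X,\mathcal{B},\mu)$ and every $\lambda\in\mathbb{R}$, $$\int_{\{f^\star>\lambda\}}f\,d\mu\ \ge\ \lambda\,\mu(\{f^\star>\lambda\}).$$
   Context: A standard probability space $(X,\mathcal{B},\mu)$: $(X,\mathcal{B})$ is a standard Borel space and $\mu$ is a complete Borel probability measure ($\mathcal{B}$ denotes the Borel sets; sets such as $\{f^\star>\lambda\}$ are measured with the complete measure $\mu$). A Borel map $T:X\to X$ is measure preserving if $\mu(T^{-1}[A])=\mu(A)$ for all $A\in\mathcal{B}$. No assumption is made on the cardinality of the fibres $T^{-1}\{x\}$. Disintegrations: for each $i\ge 1$, $\{\mu_x^i:x\in X\}$ denotes the disintegration of $\mu$ over $T^i$, i.e. the (almost everywhere unique) family of (complete) Borel probability measures such that for $\mu$-a.e. $x$, $\mu_x^i$ is supported on $T^{-i}\{x\}$ (that is, $\mu_x^i(X\setminus T^{-i}\{x\})=0$), and for every $E\in\mathcal{B}$ the function $x\mapsto\mu_x^i(E)$ is $\mu$-integrable with $\int\mu_x^i(E)\,d\mu(x)=\mu(E)$. Also $\mu_x^0=\delta_x$ is the Dirac mass at $x$. For $\mu$-a.e. $x$, $f$ is $\mu_x^i$-integrable for all $i$; $f^\star$ only needs to be considered at such $x$.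 For a probability measure $\nu$ on $(X,\mathcal{B})$, $\mathrm{MALG}(\nu)$ is the measure algebra: Borel sets modulo $\nu$-null sets, with metric $d(A,B)=\nu(A\triangle B)$. Coherent trees: for $x\in X$, $\mathrm{CT}_x$ is the set of finite sequences $E_x=(E^0,E^1,\dots,E^n)$ ($n\ge 0$) such that (1) $E^0=\{x\}$ and $E^i\in\mathrm{MALG}(\mu_x^i)$ for each $i\le n$; (2) $\mu_x^i(E^i)>0$ for each $i\le n$; (3) $\mu_x^{i+1}(E^{i+1}\setminus T^{-1}[E^i])=0$ for $0\le i<n$. The length is $\ell(E_x)=n$. The mass is $m_x(E_x)=\sum_{i=0}^{n}\mu_x^i(E^i)$. The average of $f$ over $E_x$ is $$A_{f,E_x}=\frac{\sum_{i=0}^{\ell(E_x)}\int_{E^i}f(z)\,d\mu_x^i(z)}{m_x(E_x)}.$$ *)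

theory Defs
  imports "HOL-Probability.Probability"
begin

text \<open>
  Throughout, a measure M stands for the restriction of the complete probability measure of the
  space to its Borel sets, so \<^term>\<open>sets M\<close> is the Borel \<open>\<sigma>\<close>-algebra and
  \<^term>\<open>completion M\<close> is the complete measure. The same convention applies to the
  fibre measures of a disintegration.
\<close>

definition standard_borel :: "'a measure \<Rightarrow> bool" where
  "standard_borel M \<longleftrightarrow>
     (\<exists>X. completely_metrizable_space X \<and> second_countable X \<and>
          topspace X = space M \<and> sets M = sigma_sets (topspace X) {U. openin X U})"

definition standard_prob_space :: "'a measure \<Rightarrow> bool" where
  "standard_prob_space M \<longleftrightarrow> standard_borel M \<and> prob_space M"

definition measure_preserving_map :: "'a measure \<Rightarrow> ('a \<Rightarrow> 'a) \<Rightarrow> bool" where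
  "measure_preserving_map M T \<longleftrightarrow>
     T \<in> measurable M M \<and> (\<forall>A\<in>sets M. emeasure M (T -` A \<inter> space M) = emeasure M A)"

definition disintegration :: "'a measure \<Rightarrow> ('a \<Rightarrow> 'a) \<Rightarrow> ('a \<Rightarrow> 'a measure) \<Rightarrow> bool" where
  "disintegration M S \<nu> \<longleftrightarrow>
     (\<forall>x\<in>space M. sets (\<nu> x) = sets M \<and> prob_space (\<nu> x)) \<and>
     (AE x in completion M. emeasure (\<nu> x) (space M - S -` {x}) = 0) \<and>
     (\<forall>E\<in>sets M. integrable (completion M) (\<lambda>x. measure (\<nu> x) E) \<and>
        (LINT x|completion M. measure (\<nu> x) E) = measure M E)"

text \<open>
  Elements of the measure algebra of a fibre measure are given by Borel representatives; the
  conditions below, the mass and the average depend only on the classes modulo null sets.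
  The tree \<open>(E\<^sup>0, \<dots>, E\<^sup>n)\<close> is the list of length \<open>n + 1\<close> of its levels.
\<close>

definition coherent_trees ::
    "('a \<Rightarrow> 'a) \<Rightarrow> (nat \<Rightarrow> 'a \<Rightarrow> 'a measure) \<Rightarrow> 'a \<Rightarrow> 'a set list set" where
  "coherent_trees T \<mu> x =
     {E. E \<noteq> [] \<and> E ! 0 = {x} \<and>
         (\<forall>i<length E. E ! i \<in> sets (\<mu> i x)) \<and>
         (\<forall>i<length E. measure (\<mu> i x) (E ! i) > 0) \<and>
         (\<forall>i. Suc i < length E \<longrightarrow> measure (\<mu> (Suc i) x) (E ! Suc i - T -` (E ! i)) = 0)}"

definition tree_mass :: "(nat \<Rightarrow> 'a \<Rightarrow> 'a measure) \<Rightarrow> 'a \<Rightarrow> 'a set list \<Rightarrow> real" where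
  "tree_mass \<mu> x E = (\<Sum>i<length E. measure (\<mu> i x) (E ! i))"

definition tree_average ::
    "(nat \<Rightarrow> 'a \<Rightarrow> 'a measure) \<Rightarrow> ('a \<Rightarrow> real) \<Rightarrow> 'a \<Rightarrow> 'a set list \<Rightarrow> real" where
  "tree_average \<mu> f x E =
     (\<Sum>i<length E. LINT z:(E ! i)|completion (\<mu> i x). f z) / tree_mass \<mu> x E"

text \<open>
  The supremum may be infinite. At points \<open>x\<close> where \<open>f\<close> is not integrable for some fibre
  measure (a null set if \<open>f\<close> is integrable) the value has no meaning, as such Bochner
  integrals are 0 by convention.
\<close>

definition tree_sup ::
    "('a \<Rightarrow> 'a) \<Rightarrow> (nat \<Rightarrow> 'a \<Rightarrow> 'a measure) \<Rightarrow> ('a \<Rightarrow> real) \<Rightarrow> 'a \<Rightarrow> ereal" where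
  "tree_sup T \<mu> f x = (SUP E\<in>coherent_trees T \<mu> x. ereal (tree_average \<mu> f x E))"

end

theory Submission
  imports Defs
begin

text \<open>
  Replacing \<open>f\<close> by \<open>g = f - \<lambda>\<close>, the point \<open>x\<close> lies in \<open>{f\<^sup>\<star> > \<lambda>}\<close> iff some coherent tree at \<open>x\<close> has
  \<open>\<Sum>i. \<integral>\<^bsub>E i\<^esub> g d\<mu>\<^sub>x\<^sup>i > 0\<close>. Let \<open>P\<close> be the transfer operator \<open>P h x = \<integral> h d\<mu>\<^sub>x\<^sup>1\<close>, and put \<open>w\<^sub>0 = 0\<close> and
  \<open>w\<^sub>n\<^sub>+\<^sub>1 = max 0 (g + P w\<^sub>n)\<close>. A tree over \<open>x\<close> is a family of shorter trees over points of \<open>T\<^sup>-\<^sup>1{x}\<close>,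
  so for almost every \<open>x\<close> the largest such sum over trees of length at most \<open>n\<close> is \<open>g x + P w\<^sub>n x\<close>.
  Hence \<open>{f\<^sup>\<star> > \<lambda>}\<close> is, up to a null set, the union of the sets \<open>{w\<^sub>n > 0}\<close>, and since \<open>P\<close> is positive
  and preserves integrals, Garsia's argument gives \<open>\<integral> g \<ge> 0\<close> over each of them.
\<close>

section \<open>Standard Borel spaces: points and countable generators\<close>

lemma standard_borel_singleton:
  assumes "standard_borel M" "x \<in> space M"
  shows "{x} \<in> sets M"
proof -
  obtain X where X: "completely_metrizable_space X" "topspace X = space M"
    "sets M = sigma_sets (topspace X) {U. openin X U}"
    using assms(1) by (auto simp: standard_borel_def)
  have "closedin X {x}"
    using X assms(2) by (simp add: closedin_t1_singleton metrizable_imp_t1_space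
        completely_metrizable_imp_metrizable_space)
  then have "openin X (topspace X - {x})" by blast
  then have "topspace X - {x} \<in> sets M" by (auto simp: X(3))
  then have "space M - (topspace X - {x}) \<in> sets M" by auto
  moreover have "space M - (topspace X - {x}) = {x}" using assms(2) X(2) by auto
  ultimately show ?thesis by simp
qed

text \<open>Finite intersections of a countable base form a countable \<pi>-system, and every open
  set is a countable union of base sets. Countability lets almost sure identities be made uniform
  over all Borel sets.\<close>

lemma standard_borel_countable_generator:
  assumes "standard_borel M"
  obtains G where "countable G" "Int_stable G" "G \<subseteq> Pow (space M)" "space M \<in> G"
    "sets M = sigma_sets (space M) G"
proof -
  obtain X where X: "second_countable X" "topspace X = space M"
    "sets M = sigma_sets (topspace X) {U. openin X U}"
    using assms by (auto simp: standard_borel_def)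
  obtain \<B> where "countable \<B> \<and> (\<forall>V\<in>\<B>. openin X V) \<and>
      (\<forall>U x. openin X U \<and> x \<in> U \<longrightarrow> (\<exists>V\<in>\<B>. x \<in> V \<and> V \<subseteq> U))"
    using X(1) unfolding second_countable_def by (elim exE)
  then have \<B>: "countable \<B>" "\<And>V. V \<in> \<B> \<Longrightarrow> openin X V"
    "\<And>U x. openin X U \<Longrightarrow> x \<in> U \<Longrightarrow> \<exists>V\<in>\<B>. x \<in> V \<and> V \<subseteq> U"
    by simp_all
  \<comment> \<open>The factor \<open>topspace X\<close> matters for the empty family, whose
    intersection is the whole type; it yields \<open>space M \<in> G\<close>.\<close>
  define G where "G = (\<lambda>F. topspace X \<inter> \<Inter>F) ` {F. finite F \<and> F \<subseteq> \<B>}"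
  have "countable G"
    unfolding G_def by (intro countable_image countable_Collect_finite_subset \<B>)
  moreover have "Int_stable G"
  proof (rule Int_stableI)
    fix a b assume "a \<in> G" "b \<in> G"
    then obtain F F' where "finite F" "F \<subseteq> \<B>" "finite F'" "F' \<subseteq> \<B>"
      "a = topspace X \<inter> \<Inter>F" "b = topspace X \<inter> \<Inter>F'" by (auto simp: G_def)
    then show "a \<inter> b \<in> G"
      by (auto simp: G_def intro!: image_eqI[of _ _ "F \<union> F'"])
  qed
  moreover have "G \<subseteq> Pow (space M)" by (auto simp: G_def X(2))
  moreover have "space M \<in> G" by (auto simp: G_def X(2) intro!: image_eqI[of _ _ "{}"])
  moreover have "sets M = sigma_sets (space M) G"
    unfolding X(3) X(2)
  proof (rule sigma_sets_eqI)
    fix U assume "U \<in> {U. openin X U}"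
    then have U: "openin X U" by simp
    have "U = \<Union>{V \<in> \<B>. V \<subseteq> U}" using \<B>(3)[OF U] by auto
    moreover have "\<Union>{V \<in> \<B>. V \<subseteq> U} \<in> sigma_sets (space M) G"
    proof (rule sigma_sets_UNION)
      show "countable {V \<in> \<B>. V \<subseteq> U}" using \<B>(1) by (rule countable_subset[rotated]) auto
      fix V assume "V \<in> {V \<in> \<B>. V \<subseteq> U}"
      then have "V \<in> G" using openin_subset[OF \<B>(2), of V]
        by (auto simp: G_def intro!: image_eqI[of _ _ "{V}"])
      then show "V \<in> sigma_sets (space M) G" by auto
    qed
    ultimately show "U \<in> sigma_sets (space M) G" by simp
  next
    fix V assume "V \<in> G"
    then have "openin X V" using \<B>(2) by (auto simp: G_def intro!: openin_Int_Inter)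
    then show "V \<in> sigma_sets (space M) {U. openin X U}" by auto
  qed
  ultimately show ?thesis using that by blast
qed

section \<open>Disintegrations as probability kernels\<close>

text \<open>Measurability comes from the integrability clause, which refers to the complete measure,
  so the source of the kernel is \<open>completion M\<close>. The integral clause, set by set, says
  that mixing the fibre measures gives back M.\<close>

lemma disintegration_kernel:
  assumes "prob_space M" "disintegration M S \<nu>"
  shows "\<nu> \<in> measurable (completion M) (subprob_algebra M)"
    and "completion M \<bind> \<nu> = M"
proof -
  interpret prob_space M by fact
  have \<nu>: "\<And>x. x \<in> space M \<Longrightarrow> sets (\<nu> x) = sets M" "\<And>x. x \<in> space M \<Longrightarrow> prob_space (\<nu> x)"
    "\<And>E. E \<in> sets M \<Longrightarrow> integrable (completion M) (\<lambda>x. measure (\<nu> x) E)"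
    "\<And>E. E \<in> sets M \<Longrightarrow> (LINT x|completion M. measure (\<nu> x) E) = measure M E"
    using assms(2) by (auto simp: disintegration_def)
  have em: "emeasure (\<nu> x) E = ennreal (measure (\<nu> x) E)" if "x \<in> space M" for x E
    using \<nu>(2)[OF that] by (simp add: prob_space_def finite_measure.emeasure_eq_measure)
  show K: "\<nu> \<in> measurable (completion M) (subprob_algebra M)"
  proof (rule measurable_subprob_algebra)
    fix E assume E: "E \<in> sets M"
    have "(\<lambda>x. ennreal (measure (\<nu> x) E)) \<in> borel_measurable (completion M)"
      using borel_measurable_integrable[OF \<nu>(3)[OF E]] by simp
    then show "(\<lambda>x. emeasure (\<nu> x) E) \<in> borel_measurable (completion M)"
      by (subst measurable_cong[OF em]) auto
  qed (auto simp: \<nu> prob_space_imp_subprob_space)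
  have ne: "space (completion M) \<noteq> {}" by (simp add: not_empty)
  show "completion M \<bind> \<nu> = M"
  proof (rule measure_eqI)
    show s: "sets (completion M \<bind> \<nu>) = sets M"
      by (rule sets_bind) (use \<nu>(1) ne in auto)
    fix E assume "E \<in> sets (completion M \<bind> \<nu>)"
    then have E: "E \<in> sets M" by (simp add: s)
    have "emeasure (completion M \<bind> \<nu>) E = (\<integral>\<^sup>+x. emeasure (\<nu> x) E \<partial>completion M)"
      by (rule emeasure_bind[OF ne K E])
    also have "\<dots> = (\<integral>\<^sup>+x. ennreal (measure (\<nu> x) E) \<partial>completion M)"
      by (rule nn_integral_cong) (simp add: em)
    also have "\<dots> = ennreal (measure M E)"
      by (subst nn_integral_eq_integral[OF \<nu>(3)[OF E]]) (auto simp: \<nu>(4)[OF E])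
    finally show "emeasure (completion M \<bind> \<nu>) E = emeasure M E"
      by (simp add: emeasure_eq_measure)
  qed
qed

text \<open>Integration against \<open>completion M \<bind> \<nu>\<close>, which is M, is iterated
  integration. The outer integral may be written over M because completion does not change
  nonnegative integrals.\<close>

lemma
  assumes "prob_space M" "disintegration M S \<nu>" and h: "h \<in> borel_measurable M"
  shows disintegration_measurable_nn_integral:
      "(\<lambda>x. \<integral>\<^sup>+z. h z \<partial>\<nu> x) \<in> borel_measurable (completion M)"
    and disintegration_nn_integral: "(\<integral>\<^sup>+x. \<integral>\<^sup>+z. h z \<partial>\<nu> x \<partial>M) = (\<integral>\<^sup>+z. h z \<partial>M)"
proof -
  note K = disintegration_kernel[OF assms(1,2)]
  show "(\<lambda>x. \<integral>\<^sup>+z. h z \<partial>\<nu> x) \<in> borel_measurable (completion M)"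
    by (rule measurable_compose[OF K(1) nn_integral_measurable_subprob_algebra[OF h]])
  have "(\<integral>\<^sup>+z. h z \<partial>(completion M \<bind> \<nu>)) = (\<integral>\<^sup>+x. \<integral>\<^sup>+z. h z \<partial>\<nu> x \<partial>completion M)"
    by (rule nn_integral_bind[OF h K(1)])
  then show "(\<integral>\<^sup>+x. \<integral>\<^sup>+z. h z \<partial>\<nu> x \<partial>M) = (\<integral>\<^sup>+z. h z \<partial>M)"
    by (simp add: K(2) nn_integral_completion)
qed

lemma disintegration_sets:
  assumes "disintegration M S \<nu>" "x \<in> space M"
  shows "sets (\<nu> x) = sets M" "space (\<nu> x) = space M" "prob_space (\<nu> x)"
  using assms sets_eq_imp_space_eq by (auto simp: disintegration_def)

text \<open>The fibre masses of a null Borel set are nonnegative with integral 0, so almost all of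
  them vanish.\<close>

lemma disintegration_AE:
  assumes "prob_space M" "disintegration M S \<nu>" "AE z in M. Q z"
  shows "AE x in M. AE z in \<nu> x. Q z"
proof -
  obtain N where N: "{z \<in> space M. \<not> Q z} \<subseteq> N" "emeasure M N = 0" "N \<in> sets M"
    using assms(3) by (rule AE_E)
  have m: "(\<lambda>x. \<integral>\<^sup>+z. indicator N z \<partial>\<nu> x) \<in> borel_measurable (completion M)"
    by (rule disintegration_measurable_nn_integral[OF assms(1,2)]) (use N in measurable)
  have "(\<integral>\<^sup>+x. \<integral>\<^sup>+z. indicator N z \<partial>\<nu> x \<partial>completion M) = 0"
    using N by (simp add: nn_integral_completion disintegration_nn_integral[OF assms(1,2)])
  then have "AE x in M. (\<integral>\<^sup>+z. indicator N z \<partial>\<nu> x) = 0"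
    using nn_integral_0_iff_AE[OF m] by (simp add: AE_completion_iff)
  with AE_space show ?thesis
  proof eventually_elim
    case (elim x)
    note \<nu> = disintegration_sets[OF assms(2) elim(1)]
    have "N \<in> null_sets (\<nu> x)" using elim N by (auto simp: \<nu>)
    then show ?case by (rule AE_I') (use N in \<open>auto simp: \<nu>\<close>)
  qed
qed

lemma disintegration_integrable:
  fixes h :: "'a \<Rightarrow> real"
  assumes "prob_space M" "disintegration M S \<nu>" and h: "integrable M h"
  shows "AE x in M. integrable (\<nu> x) h"
proof -
  have hm[measurable]: "h \<in> borel_measurable M" using h by auto
  have m: "(\<lambda>x. \<integral>\<^sup>+z. ennreal (norm (h z)) \<partial>\<nu> x) \<in> borel_measurable (completion M)"
    by (rule disintegration_measurable_nn_integral[OF assms(1,2)]) simp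
  have "(\<integral>\<^sup>+x. \<integral>\<^sup>+z. ennreal (norm (h z)) \<partial>\<nu> x \<partial>completion M) \<noteq> \<infinity>"
    using h by (simp add: nn_integral_completion disintegration_nn_integral[OF assms(1,2)]
        integrable_iff_bounded less_top)
  from nn_integral_PInf_AE[OF m this]
  have "AE x in M. (\<integral>\<^sup>+z. ennreal (norm (h z)) \<partial>\<nu> x) \<noteq> \<infinity>" by (simp add: AE_completion_iff)
  with AE_space show ?thesis
  proof eventually_elim
    case (elim x)
    have "h \<in> borel_measurable (\<nu> x)"
      using hm disintegration_sets[OF assms(2) elim(1)] by (simp cong: measurable_cong_sets)
    then show ?case using elim(2) by (simp add: integrable_iff_bounded less_top)
  qed
qed

lemma disintegration_fibre:
  assumes "standard_prob_space M" "S \<in> measurable M M" "disintegration M S \<nu>"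
  shows "AE x in M. AE z in \<nu> x. S z = x"
proof -
  have "AE x in M. emeasure (\<nu> x) (space M - S -` {x}) = 0"
    using assms(3) by (simp add: disintegration_def AE_completion_iff)
  with AE_space show ?thesis
  proof eventually_elim
    case (elim x)
    note \<nu> = disintegration_sets[OF assms(3) elim(1)]
    \<comment> \<open>\<open>emeasure\<close> is 0 on non-measurable sets, so the support clause
      yields a null set only once the fibre is known to be Borel.\<close>
    have "{x} \<in> sets M"
      using assms(1) elim(1) by (simp add: standard_prob_space_def standard_borel_singleton)
    then have "space M - (S -` {x} \<inter> space M) \<in> sets M"
      using assms(2) by measurable
    moreover have "space M - (S -` {x} \<inter> space M) = space M - S -` {x}" by auto
    ultimately have "space M - S -` {x} \<in> null_sets (\<nu> x)"
      using elim(2) by (auto simp: \<nu>)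
    then show ?case by (rule AE_I') (auto simp: \<nu>)
  qed
qed

text \<open>Covers \<open>T ^^ 0\<close>, so that the root level of a tree obeys the same statements
  as the higher levels.\<close>

lemma disintegration_return:
  assumes "standard_prob_space M" "\<And>x. x \<in> space M \<Longrightarrow> \<nu> x = return M x"
  shows "disintegration M id \<nu>"
proof -
  have "prob_space M" using assms(1) by (simp add: standard_prob_space_def)
  then interpret prob_space M .
  have eq: "measure (\<nu> x) E = indicator E x" if "x \<in> space M" "E \<in> sets M" for x E
    using that by (simp add: assms(2) measure_return)
  show ?thesis
    unfolding disintegration_def
  proof (intro conjI ballI)
    show "AE x in completion M. emeasure (\<nu> x) (space M - id -` {x}) = 0"
    proof (rule AE_I2)
      fix x assume "x \<in> space (completion M)"
      then have x: "x \<in> space M" by simp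
      then have "{x} \<in> sets M"
        using assms(1) by (simp add: standard_prob_space_def standard_borel_singleton)
      then show "emeasure (\<nu> x) (space M - id -` {x}) = 0"
        using x by (simp add: assms(2) emeasure_return)
    qed
  next
    fix E assume E: "E \<in> sets M"
    have "integrable (completion M) (\<lambda>x. measure (\<nu> x) E) \<longleftrightarrow>
        integrable (completion M) (indicat_real E)"
      by (rule Bochner_Integration.integrable_cong) (auto simp: eq E)
    also have "\<dots>" using E by (subst integrable_completion) (auto simp: emeasure_eq_measure)
    finally show "integrable (completion M) (\<lambda>x. measure (\<nu> x) E)" .
    have "(LINT x|completion M. measure (\<nu> x) E) = (LINT x|completion M. indicat_real E x)"
      by (rule Bochner_Integration.integral_cong) (auto simp: eq E)
    also have "\<dots> = measure M E" using E by (subst integral_completion) auto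
    finally show "(LINT x|completion M. measure (\<nu> x) E) = measure M E" .
  qed (auto simp: assms(2) prob_space_return)
qed

section \<open>Conditional expectations and disintegrations over compositions\<close>

text \<open>Borel versions of p and q are densities of the same measure over a finite measure, hence
  agree almost everywhere.\<close>

lemma AE_eq_if_set_nn_integrals_eq:
  fixes p q :: "'a \<Rightarrow> ennreal"
  assumes "prob_space M"
    and p: "p \<in> borel_measurable (completion M)" and q: "q \<in> borel_measurable (completion M)"
    and eq: "\<And>A. A \<in> sets M \<Longrightarrow>
      (\<integral>\<^sup>+x. p x * indicator A x \<partial>M) = (\<integral>\<^sup>+x. q x * indicator A x \<partial>M)"
  shows "AE x in M. p x = q x"
proof -
  interpret prob_space M by fact
  obtain p' where p': "p' \<in> borel_measurable M" "AE x in M. p x = p' x"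
    using completion_ex_borel_measurable[OF p] by auto
  obtain q' where q': "q' \<in> borel_measurable M" "AE x in M. q x = q' x"
    using completion_ex_borel_measurable[OF q] by auto
  have "AE x in M. p' x = q' x"
  proof (rule density_unique_finite_measure[OF p'(1) q'(1)])
    fix A assume A: "A \<in> sets M"
    have "(\<integral>\<^sup>+x. p' x * indicator A x \<partial>M) = (\<integral>\<^sup>+x. p x * indicator A x \<partial>M)"
      by (rule nn_integral_cong_AE) (use p'(2) in eventually_elim, simp)
    also have "\<dots> = (\<integral>\<^sup>+x. q' x * indicator A x \<partial>M)"
      unfolding eq[OF A] by (rule nn_integral_cong_AE) (use q'(2) in eventually_elim, simp)
    finally show "(\<integral>\<^sup>+x. p' x * indicator A x \<partial>M) = (\<integral>\<^sup>+x. q' x * indicator A x \<partial>M)" .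
  qed auto
  with p'(2) q'(2) show ?thesis by eventually_elim simp
qed

text \<open>Almost every fibre measure lives where \<open>S z = x\<close>, so
  \<open>indicator A x\<close> moves under the inner integral as \<open>indicator A (S z)\<close>.
  This identifies the fibre integral of h as its conditional expectation given
  \<open>S = x\<close>.\<close>

lemma disintegration_nn_integral_indicator:
  assumes "standard_prob_space M" and S: "S \<in> measurable M M" and D: "disintegration M S \<nu>"
    and h[measurable]: "h \<in> borel_measurable M" and A[measurable]: "A \<in> sets M"
  shows "(\<integral>\<^sup>+x. (\<integral>\<^sup>+z. h z \<partial>\<nu> x) * indicator A x \<partial>M) = (\<integral>\<^sup>+z. h z * indicator A (S z) \<partial>M)"
proof -
  have P: "prob_space M" using assms(1) by (simp add: standard_prob_space_def)
  note S[measurable]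
  have "(\<integral>\<^sup>+x. (\<integral>\<^sup>+z. h z \<partial>\<nu> x) * indicator A x \<partial>M) =
      (\<integral>\<^sup>+x. \<integral>\<^sup>+z. h z * indicator A (S z) \<partial>\<nu> x \<partial>M)"
  proof (rule nn_integral_cong_AE)
    show "AE x in M. (\<integral>\<^sup>+z. h z \<partial>\<nu> x) * indicator A x = (\<integral>\<^sup>+z. h z * indicator A (S z) \<partial>\<nu> x)"
      using AE_space disintegration_fibre[OF assms(1-3)]
    proof eventually_elim
      case (elim x)
      have hx: "h \<in> borel_measurable (\<nu> x)"
        using h disintegration_sets[OF D elim(1)] by (simp cong: measurable_cong_sets)
      have "(\<integral>\<^sup>+z. h z * indicator A (S z) \<partial>\<nu> x) = (\<integral>\<^sup>+z. h z * indicator A x \<partial>\<nu> x)"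
        by (rule nn_integral_cong_AE) (use elim(2) in eventually_elim, simp)
      also have "\<dots> = (\<integral>\<^sup>+z. h z \<partial>\<nu> x) * indicator A x"
        by (rule nn_integral_multc[OF hx])
      finally show ?case by simp
    qed
  qed
  also have "\<dots> = (\<integral>\<^sup>+z. h z * indicator A (S z) \<partial>M)"
    by (rule disintegration_nn_integral[OF P D]) measurable
  finally show ?thesis .
qed

text \<open>
  For a fixed \<open>E\<close> the identity holds almost everywhere because both sides have the same integrals
  over all \<open>A \<in> sets M\<close>; a countable \<open>\<pi>\<close>-system of sets \<open>E\<close> makes the exceptional null set uniform.
\<close>

lemma disintegration_comp:
  fixes h u :: "'a \<Rightarrow> ennreal"
  assumes std: "standard_prob_space M"
    and S[measurable]: "S \<in> measurable M M" and T[measurable]: "T \<in> measurable M M"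
    and D: "disintegration M S \<nu>" "disintegration M T \<rho>" "disintegration M (S \<circ> T) \<kappa>"
    and h[measurable]: "h \<in> borel_measurable M" and fin: "(\<integral>\<^sup>+z. h z \<partial>M) \<noteq> \<infinity>"
    and u[measurable]: "u \<in> borel_measurable M" and u_eq: "AE x in M. u x = (\<integral>\<^sup>+z. h z \<partial>\<rho> x)"
  shows "AE x in M. \<forall>E\<in>sets M.
    (\<integral>\<^sup>+z. h z * indicator (T -` E \<inter> space M) z \<partial>\<kappa> x) = (\<integral>\<^sup>+z. u z * indicator E z \<partial>\<nu> x)"
proof -
  have P: "prob_space M" and B: "standard_borel M"
    using std by (auto simp: standard_prob_space_def)
  have one: "AE x in M. (\<integral>\<^sup>+z. h z * indicator (T -` E \<inter> space M) z \<partial>\<kappa> x) =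
      (\<integral>\<^sup>+z. u z * indicator E z \<partial>\<nu> x)" if E[measurable]: "E \<in> sets M" for E
  proof (rule AE_eq_if_set_nn_integrals_eq[OF P])
    fix A assume A[measurable]: "A \<in> sets M"
    \<comment> \<open>First the fibres of S are integrated out, then u is unfolded over the fibres
      of T. Both conditions then sit on \<open>T z\<close> and \<open>(S \<circ> T) z\<close>, which
      is the form belonging to \<open>\<kappa>\<close>.\<close>
    have "(\<integral>\<^sup>+x. (\<integral>\<^sup>+z. u z * indicator E z \<partial>\<nu> x) * indicator A x \<partial>M) =
        (\<integral>\<^sup>+z. u z * indicator E z * indicator A (S z) \<partial>M)"
      by (rule disintegration_nn_integral_indicator[OF std S D(1)]) measurable
    also have "\<dots> = (\<integral>\<^sup>+z. (\<integral>\<^sup>+y. h y \<partial>\<rho> z) * indicator (S -` A \<inter> E \<inter> space M) z \<partial>M)"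
      by (rule nn_integral_cong_AE)
        (use u_eq AE_space in eventually_elim, auto simp: indicator_def)
    also have "\<dots> = (\<integral>\<^sup>+z. h z * indicator (S -` A \<inter> E \<inter> space M) (T z) \<partial>M)"
    proof (rule disintegration_nn_integral_indicator[OF std T D(2) h])
      have "S -` A \<inter> space M \<inter> E \<in> sets M" by measurable
      then show "S -` A \<inter> E \<inter> space M \<in> sets M" by (simp add: Int_ac)
    qed
    also have "\<dots> = (\<integral>\<^sup>+z. h z * indicator (T -` E \<inter> space M) z * indicator A ((S \<circ> T) z) \<partial>M)"
      by (rule nn_integral_cong)
        (use measurable_space[OF T] in \<open>auto simp: indicator_def\<close>)
    also have "\<dots> = (\<integral>\<^sup>+x. (\<integral>\<^sup>+z. h z * indicator (T -` E \<inter> space M) z \<partial>\<kappa> x) * indicator A x \<partial>M)"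
      by (rule disintegration_nn_integral_indicator[OF std _ D(3), symmetric]) measurable
    finally show "(\<integral>\<^sup>+x. (\<integral>\<^sup>+z. h z * indicator (T -` E \<inter> space M) z \<partial>\<kappa> x) * indicator A x \<partial>M) =
        (\<integral>\<^sup>+x. (\<integral>\<^sup>+z. u z * indicator E z \<partial>\<nu> x) * indicator A x \<partial>M)" by simp
  qed (auto intro!: disintegration_measurable_nn_integral[OF P D(3)]
      disintegration_measurable_nn_integral[OF P D(1)])
  obtain G where G: "countable G" "Int_stable G" "G \<subseteq> Pow (space M)" "space M \<in> G"
    "sets M = sigma_sets (space M) G" using standard_borel_countable_generator[OF B] .
  have "\<forall>E\<in>G. AE x in M. (\<integral>\<^sup>+z. h z * indicator (T -` E \<inter> space M) z \<partial>\<kappa> x) =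
      (\<integral>\<^sup>+z. u z * indicator E z \<partial>\<nu> x)"
    using one G(5) by auto
  then have gen: "AE x in M. \<forall>E\<in>G. (\<integral>\<^sup>+z. h z * indicator (T -` E \<inter> space M) z \<partial>\<kappa> x) =
      (\<integral>\<^sup>+z. u z * indicator E z \<partial>\<nu> x)"
    using G(1) by (simp add: AE_ball_countable)
  have "(\<integral>\<^sup>+x. (\<integral>\<^sup>+z. h z \<partial>\<kappa> x) \<partial>completion M) \<noteq> \<infinity>"
    using fin by (simp add: nn_integral_completion disintegration_nn_integral[OF P D(3)])
  from nn_integral_PInf_AE[OF disintegration_measurable_nn_integral[OF P D(3) h] this]
  have "AE x in M. (\<integral>\<^sup>+z. h z \<partial>\<kappa> x) \<noteq> \<infinity>" by (simp add: AE_completion_iff)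
  with gen AE_space show ?thesis
  proof eventually_elim
    case (elim x)
    note \<nu> = disintegration_sets[OF D(1) elim(2)] and \<kappa> = disintegration_sets[OF D(3) elim(2)]
    have m: "h \<in> borel_measurable (\<kappa> x)" "u \<in> borel_measurable (\<nu> x)"
      "T \<in> measurable (density (\<kappa> x) h) M"
      using \<nu> \<kappa> h u T by (simp_all cong: measurable_cong_sets)
    have L: "emeasure (distr (density (\<kappa> x) h) M T) E =
        (\<integral>\<^sup>+z. h z * indicator (T -` E \<inter> space M) z \<partial>\<kappa> x)" if "E \<in> sets M" for E
      using that m \<kappa> measurable_sets[OF T that] by (simp add: emeasure_distr emeasure_density)
    have R: "emeasure (density (\<nu> x) u) E = (\<integral>\<^sup>+z. u z * indicator E z \<partial>\<nu> x)"
      if "E \<in> sets M" for E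
      using that m \<nu> by (simp add: emeasure_density)
    \<comment> \<open>As functions of E the two sides are measures. They agree on the \<pi>-system
      G, and the total mass \<open>\<integral>h d\<kappa> x\<close> is finite for almost every x, so
      they coincide.\<close>
    have "distr (density (\<kappa> x) h) M T = density (\<nu> x) u"
    proof (rule measure_eqI_generator_eq[OF G(2,3), where A = "\<lambda>_. space M"])
      fix E assume "E \<in> G"
      then show "emeasure (distr (density (\<kappa> x) h) M T) E = emeasure (density (\<nu> x) u) E"
        using elim(1) G(5) L R by auto
    next
      have "emeasure (distr (density (\<kappa> x) h) M T) (space M) =
          (\<integral>\<^sup>+z. h z * indicator (T -` space M \<inter> space M) z \<partial>\<kappa> x)" by (rule L) simp
      also have "\<dots> = (\<integral>\<^sup>+z. h z \<partial>\<kappa> x)"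
        by (rule nn_integral_cong)
          (use measurable_space[OF T] in \<open>auto simp: \<kappa> indicator_def\<close>)
      finally show "emeasure (distr (density (\<kappa> x) h) M T) (space M) \<noteq> \<infinity>"
        using elim(3) by simp
    qed (use G \<nu> in auto)
    then show ?case using L R by simp
  qed
qed

text \<open>With \<open>S = T ^^ i\<close> this carries an integral over the preimage of a level
  back to that level, w being replaced by its transfer u. It is the source of the recursion over
  trees.\<close>

lemma disintegration_comp_set_integral:
  fixes w u :: "'a \<Rightarrow> real"
  assumes std: "standard_prob_space M"
    and S: "S \<in> measurable M M" and T: "T \<in> measurable M M"
    and D: "disintegration M S \<nu>" "disintegration M T \<rho>" "disintegration M (S \<circ> T) \<kappa>"
    and w: "integrable M w" "\<And>z. 0 \<le> w z" and u: "integrable M u" "\<And>z. 0 \<le> u z"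
    and u_eq: "AE x in M. ennreal (u x) = (\<integral>\<^sup>+z. ennreal (w z) \<partial>\<rho> x)"
  shows "AE x in M. \<forall>E\<in>sets M.
    (LINT z:(T -` E \<inter> space M)|\<kappa> x. w z) = (LINT z:E|\<nu> x. u z)"
proof -
  have m[measurable]: "w \<in> borel_measurable M" "u \<in> borel_measurable M" using w u by auto
  have "(\<integral>\<^sup>+z. ennreal (w z) \<partial>M) \<noteq> \<infinity>"
    using w by (simp add: integrable_iff_bounded less_top)
  then have "AE x in M. \<forall>E\<in>sets M.
      (\<integral>\<^sup>+z. ennreal (w z) * indicator (T -` E \<inter> space M) z \<partial>\<kappa> x) =
      (\<integral>\<^sup>+z. ennreal (u z) * indicator E z \<partial>\<nu> x)"
    by (intro disintegration_comp[OF std S T D] u_eq) auto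
  with AE_space show ?thesis
  proof eventually_elim
    case (elim x)
    note \<nu> = disintegration_sets[OF D(1) elim(1)] and \<kappa> = disintegration_sets[OF D(3) elim(1)]
    \<comment> \<open>Also true for divergent integrals: the left side is then 0 by convention, and
      \<open>enn2real\<close> sends \<infinity> to 0.\<close>
    have eq: "(LINT z:A|N. v z) = enn2real (\<integral>\<^sup>+z. ennreal (v z) * indicator A z \<partial>N)"
      if "A \<in> sets N" "v \<in> borel_measurable N" "\<And>z. 0 \<le> v z" for A N and v :: "'a \<Rightarrow> real"
      unfolding set_lebesgue_integral_def using that
      by (subst integral_eq_nn_integral)
        (auto intro!: arg_cong[where f = enn2real] nn_integral_cong simp: indicator_def)
    have "(LINT z:(T -` E \<inter> space M)|\<kappa> x. w z) = (LINT z:E|\<nu> x. u z)"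
      if E: "E \<in> sets M" for E
    proof -
      have "(LINT z:(T -` E \<inter> space M)|\<kappa> x. w z) =
          enn2real (\<integral>\<^sup>+z. ennreal (w z) * indicator (T -` E \<inter> space M) z \<partial>\<kappa> x)"
        using m(1) w(2) measurable_sets[OF T E] \<kappa>
        by (intro eq) (simp_all cong: measurable_cong_sets)
      also have "\<dots> = (LINT z:E|\<nu> x. u z)"
        unfolding elim(2)[rule_format, OF E] using m(2) u(2) E \<nu>
        by (intro eq[symmetric]) (simp_all cong: measurable_cong_sets)
      finally show ?thesis .
    qed
    then show ?case by blast
  qed
qed

section \<open>The transfer operator and Borel versions\<close>

text \<open>The fibre integral of w is measurable only for the completion and may be infinite on a
  null set. Applying \<open>enn2real\<close> to a Borel version repairs both and keeps the
  integral.\<close>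

lemma disintegration_transfer:
  fixes w :: "'a \<Rightarrow> real"
  assumes P: "prob_space M" and D: "disintegration M T \<rho>"
    and w: "integrable M w" "\<And>z. 0 \<le> w z"
  shows "\<exists>u. integrable M u \<and> (\<forall>z. 0 \<le> u z) \<and>
    (AE x in M. ennreal (u x) = (\<integral>\<^sup>+z. ennreal (w z) \<partial>\<rho> x)) \<and>
    (LINT x|M. u x) = (LINT x|M. w x)"
proof -
  define v where "v x = (\<integral>\<^sup>+z. ennreal (w z) \<partial>\<rho> x)" for x
  have wm: "(\<lambda>z. ennreal (w z)) \<in> borel_measurable M" using w(1) by auto
  have v: "v \<in> borel_measurable (completion M)"
    unfolding v_def by (rule disintegration_measurable_nn_integral[OF P D wm])
  have iv: "(\<integral>\<^sup>+x. v x \<partial>M) = ennreal (LINT x|M. w x)"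
    unfolding v_def disintegration_nn_integral[OF P D wm]
    by (rule nn_integral_eq_integral[OF w(1)]) (simp add: w)
  then have "AE x in completion M. v x \<noteq> \<infinity>"
    using v by (intro nn_integral_PInf_AE) (auto simp: nn_integral_completion)
  then have vfin: "AE x in M. v x \<noteq> \<infinity>" by (simp add: AE_completion_iff)
  obtain v' where v': "v' \<in> borel_measurable M" "AE x in M. v x = v' x"
    using completion_ex_borel_measurable[OF v] by auto
  define u where "u x = enn2real (v' x)" for x
  have um: "u \<in> borel_measurable M" unfolding u_def using v' by auto
  have uv: "AE x in M. ennreal (u x) = v x"
    using vfin v'(2) by eventually_elim (auto simp: u_def less_top)
  have iu: "(\<integral>\<^sup>+x. ennreal (u x) \<partial>M) = ennreal (LINT x|M. w x)"
    unfolding iv[symmetric] by (rule nn_integral_cong_AE[OF uv])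
  have "integrable M u"
    using um iu by (intro integrableI_nonneg) (auto simp: u_def)
  moreover have "(LINT x|M. u x) = (LINT x|M. w x)"
    using iu w(2) um by (subst integral_eq_nn_integral) (auto simp: u_def)
  ultimately show ?thesis
    using uv by (intro exI[of _ u]) (auto simp: u_def v_def)
qed

lemma borel_measurable_completion_AE:
  assumes "AE z in M. f z = f' z" "f' \<in> borel_measurable M"
  shows "f \<in> borel_measurable (completion M)"
proof (rule measurableI)
  fix B :: "'b set" assume B: "B \<in> sets borel"
  have "f -` B \<inter> space M \<in> sets (completion M)"
  proof (rule completion.in_sets_AE)
    show "AE z in completion M. z \<in> f' -` B \<inter> space M \<longleftrightarrow> z \<in> f -` B \<inter> space M"
      unfolding AE_completion_iff using assms(1) AE_space by eventually_elim auto
    show "f' -` B \<inter> space M \<in> sets (completion M)"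
      using measurable_sets[OF assms(2) B] by simp
  qed simp
  then show "f -` B \<inter> space (completion M) \<in> sets (completion M)" by simp
qed auto

text \<open>Used on the fibres, to trade f for a Borel version, and on M itself, to trade the level
  set for a Borel set as well.\<close>

lemma set_integral_completion_AE:
  fixes f f' :: "'a \<Rightarrow> real"
  assumes "AE z in M. f z = f' z" "f' \<in> borel_measurable M" "A \<in> sets (completion M)"
    "B \<in> sets M" "AE z in M. z \<in> A \<longleftrightarrow> z \<in> B"
  shows "(LINT z:A|completion M. f z) = (LINT z:B|M. f' z)"
proof -
  note f = borel_measurable_completion_AE[OF assms(1,2)]
  have "(LINT z:A|completion M. f z) = (LINT z:B|completion M. f' z)"
    unfolding set_lebesgue_integral_def
  proof (rule integral_cong_AE)
    show "AE z in completion M. indicator A z *\<^sub>R f z = indicator B z *\<^sub>R f' z"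
      unfolding AE_completion_iff using assms(1,5) by eventually_elim (auto simp: indicator_def)
  qed (use f assms(3,4) measurable_completion[OF assms(2)] in
      \<open>auto intro!: borel_measurable_scaleR borel_measurable_indicator simp del: real_scaleR_def\<close>)
  also have "\<dots> = (LINT z:B|M. f' z)"
    unfolding set_lebesgue_integral_def using assms(2,4)
    by (intro integral_completion borel_measurable_scaleR borel_measurable_indicator)
  finally show ?thesis .
qed

section \<open>Sums over coherent trees at a fixed point\<close>

text \<open>
  Here \<open>m i\<close> stands for the fibre measure \<open>\<mu> i x\<close> at a fixed point \<open>x\<close>, and the integral of \<open>w k\<close>
  over the preimage of a level is the best total contribution of the next \<open>k\<close> levels.
\<close>

locale tree_recursion =
  fixes M :: "'a measure" and T :: "'a \<Rightarrow> 'a" and m :: "nat \<Rightarrow> 'a measure"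
    and g :: "'a \<Rightarrow> real" and w u :: "nat \<Rightarrow> 'a \<Rightarrow> real"
  assumes T[measurable]: "T \<in> measurable M M"
    and sets_m: "\<And>i. sets (m i) = sets M" and finite_m: "\<And>i. finite_measure (m i)"
    and int: "\<And>i. integrable (m i) g" "\<And>i k. integrable (m i) (w k)"
      "\<And>i k. integrable (m i) (u k)"
    and transfer: "\<And>i k E. E \<in> sets M \<Longrightarrow>
      (LINT z:(T -` E \<inter> space M)|m (Suc i). w k z) = (LINT z:E|m i. u k z)"
    and w_0: "\<And>z. w 0 z = 0"
    and w_Suc: "\<And>k z. w (Suc k) z = max 0 (g z + u k z)"
begin

lemma w_nonneg: "0 \<le> w k z"
  by (cases k) (auto simp: w_0 w_Suc)

lemma set_int:
  assumes "A \<in> sets M"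
  shows "set_integrable (m i) A g" "set_integrable (m i) A (w k)" "set_integrable (m i) A (u k)"
  using assms int sets_m unfolding set_integrable_def
  by (auto intro!: integrable_mult_indicator simp del: real_scaleR_def)

lemma set_integral_w_Suc_ge:
  assumes "A \<in> sets M"
  shows "(LINT z:A|m i. g z) + (LINT z:A|m i. u k z) \<le> (LINT z:A|m i. w (Suc k) z)"
  unfolding set_integral_add(2)[OF set_int(1,3)[OF assms], symmetric]
  by (intro set_integral_mono set_integral_add set_int assms) (simp add: w_Suc)

text \<open>The sum up to level j plus the integral of \<open>u (n - j)\<close> over level j, a
  bound for what later levels can add, never increases with j; the right side is its value at the
  root.\<close>

lemma sum_tree_le:
  assumes E: "\<And>i. i \<le> n \<Longrightarrow> E i \<in> sets M"
    and coherent: "\<And>i. i < n \<Longrightarrow> measure (m (Suc i)) (E (Suc i) - T -` E i) = 0"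
  shows "(\<Sum>i\<le>n. LINT z:E i|m i. g z) \<le> (LINT z:E 0|m 0. g z) + (LINT z:E 0|m 0. u n z)"
proof -
  have "(\<Sum>i\<le>j. LINT z:E i|m i. g z) \<le>
      (LINT z:E 0|m 0. g z) + (LINT z:E 0|m 0. u n z) - (LINT z:E j|m j. u (n - j) z)"
    if "j \<le> n" for j
    using that
  proof (induction j)
    case (Suc j)
    have Ej[measurable]: "E j \<in> sets M" "E (Suc j) \<in> sets M" using E Suc.prems by auto
    have Tj: "T -` E j \<inter> space M \<in> sets M" by measurable
    interpret mj: finite_measure "m (Suc j)" by (rule finite_m)
    have k: "n - j = Suc (n - Suc j)" using Suc.prems by simp
    have "E (Suc j) - T -` E j = E (Suc j) - (T -` E j \<inter> space M)"
      using sets.sets_into_space[OF Ej(2)] by auto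
    then have "E (Suc j) - T -` E j \<in> sets M" using Tj Ej by auto
    then have "E (Suc j) - T -` E j \<in> null_sets (m (Suc j))"
      using coherent[of j] Suc.prems by (simp add: null_sets_def sets_m mj.emeasure_eq_measure)
    then have ae: "AE z in m (Suc j). z \<notin> E (Suc j) - T -` E j" by (rule AE_not_in)
    have "(LINT z:E (Suc j)|m (Suc j). g z) + (LINT z:E (Suc j)|m (Suc j). u (n - Suc j) z)
        \<le> (LINT z:E (Suc j)|m (Suc j). w (n - j) z)"
      unfolding k by (rule set_integral_w_Suc_ge[OF Ej(2)])
    \<comment> \<open>Coherence puts the level inside the preimage up to a null set, and w is
      nonnegative.\<close>
    also have "\<dots> \<le> (LINT z:(T -` E j \<inter> space M)|m (Suc j). w (n - j) z)"
      unfolding set_lebesgue_integral_def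
    proof (rule integral_mono_AE)
      show "AE z in m (Suc j). indicat_real (E (Suc j)) z *\<^sub>R w (n - j) z
          \<le> indicat_real (T -` E j \<inter> space M) z *\<^sub>R w (n - j) z"
        using ae by eventually_elim
          (use sets.sets_into_space[OF Ej(2)] w_nonneg in \<open>auto simp: indicator_def\<close>)
    qed (use set_int(2)[OF Ej(2)] set_int(2)[OF Tj] in \<open>auto simp: set_integrable_def\<close>)
    also have "\<dots> = (LINT z:E j|m j. u (n - j) z)" by (rule transfer[OF Ej(1)])
    finally show ?case using Suc by simp
  qed simp
  \<comment> \<open>At \<open>j = n\<close> the remaining term is an integral of \<open>u 0\<close>,
    which \<open>transfer\<close> turns into one of \<open>w 0 = 0\<close>.\<close>
  from this[of n] show ?thesis
    using transfer[OF E[of n], of n 0] by (simp add: w_0)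
qed

text \<open>
  Level \<open>i + 1\<close> of a tree of length at most \<open>n\<close> can still be followed by \<open>n - i - 1\<close> levels; the greedy
  tree keeps exactly the points where this remaining contribution is positive.
\<close>

primrec greedy_level :: "nat \<Rightarrow> 'a set \<Rightarrow> nat \<Rightarrow> 'a set" where
  "greedy_level n R 0 = R"
| "greedy_level n R (Suc i) = {z \<in> T -` greedy_level n R i \<inter> space M. 0 < w (n - i) z}"

context
  fixes n :: nat and R :: "'a set"
  assumes w_meas[measurable]: "\<And>k. w k \<in> borel_measurable M" and R[measurable]: "R \<in> sets M"
begin

lemma greedy_level_sets[measurable]: "greedy_level n R i \<in> sets M"
proof (induction i)
  case (Suc i)
  note Suc[measurable]
  have "greedy_level n R (Suc i) =
      (T -` greedy_level n R i \<inter> space M) \<inter> {z \<in> space M. 0 < w (n - i) z}" by auto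
  then show ?case by simp
qed simp

text \<open>Points of the preimage dropped by the greedy choice have \<open>w (n - j) z = 0\<close>,
  so they contribute nothing.\<close>

lemma set_integral_greedy_level:
  "(LINT z:greedy_level n R j|m j. u (n - j) z) =
    (LINT z:greedy_level n R (Suc j)|m (Suc j). w (n - j) z)"
proof -
  have "indicat_real (T -` greedy_level n R j \<inter> space M) z *\<^sub>R w (n - j) z
      = indicat_real (greedy_level n R (Suc j)) z *\<^sub>R w (n - j) z" for z
    using w_nonneg[of "n - j" z] by (auto simp: indicator_def)
  then show ?thesis
    unfolding transfer[OF greedy_level_sets, symmetric]
    unfolding set_lebesgue_integral_def by presburger
qed

text \<open>For greedy levels the estimates behind \<open>sum_tree_le\<close> are equalities: where
  w is positive the maximum in \<open>w_Suc\<close> is \<open>g + u\<close>. The subtracted term is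
  the contribution still to come after level j.\<close>

lemma sum_greedy_level:
  assumes "j \<le> n"
  shows "(\<Sum>i\<le>j. LINT z:greedy_level n R i|m i. g z) =
    (LINT z:R|m 0. g z) + (LINT z:R|m 0. u n z) -
    (LINT z:greedy_level n R (Suc j)|m (Suc j). w (n - j) z)"
  using assms
proof (induction j)
  case 0
  show ?case using set_integral_greedy_level[of 0] by simp
next
  case (Suc j)
  define F where "F = greedy_level n R (Suc j)"
  have F: "F \<in> sets M" unfolding F_def by (rule greedy_level_sets)
  have k: "n - j = Suc (n - Suc j)" using Suc.prems by simp
  have "(LINT z:F|m (Suc j). w (n - j) z) = (LINT z:F|m (Suc j). g z + u (n - Suc j) z)"
    unfolding k using F by (intro set_lebesgue_integral_cong)
      (auto simp: sets_m F_def w_Suc k)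
  also have "\<dots> = (LINT z:F|m (Suc j). g z) + (LINT z:F|m (Suc j). u (n - Suc j) z)"
    using set_int[OF F] by simp
  finally show ?case
    using Suc set_integral_greedy_level[of "Suc j"] by (simp add: F_def)
qed

text \<open>The levels of a coherent tree must not be null, so the greedy tree is cut at its first null level.\<close>

lemma greedy_tree:
  assumes root: "0 < measure (m 0) R"
  obtains l where "\<And>i. i \<le> l \<Longrightarrow> 0 < measure (m i) (greedy_level n R i)"
    "(\<Sum>i\<le>l. LINT z:greedy_level n R i|m i. g z) = (LINT z:R|m 0. g z) + (LINT z:R|m 0. u n z)"
proof -
  define Q where "Q i \<longleftrightarrow> measure (m i) (greedy_level n R i) = 0" for i
  \<comment> \<open>Level \<open>Suc n\<close> asks for \<open>0 < w 0 z\<close>, so it is empty and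
    a first null level exists.\<close>
  have "Q (Suc n)" by (simp add: Q_def w_0)
  define L where "L = (LEAST i. Q i)"
  have QL: "Q L" and Lle: "L \<le> Suc n" and below: "\<And>i. i < L \<Longrightarrow> \<not> Q i"
    unfolding L_def using LeastI[of Q, OF \<open>Q (Suc n)\<close>] Least_le[of Q, OF \<open>Q (Suc n)\<close>]
    by (auto dest: not_less_Least)
  have "L \<noteq> 0" using QL root unfolding Q_def by (metis greedy_level.simps(1) less_irrefl)
  then obtain l where l: "L = Suc l" by (cases L) auto
  interpret ml: finite_measure "m L" by (rule finite_m)
  \<comment> \<open>The contribution still to come after level l is an integral over the null level
    L, so cutting there loses nothing.\<close>
  have "greedy_level n R L \<in> null_sets (m L)"
    using QL greedy_level_sets[of L] by (simp add: null_sets_def Q_def sets_m ml.emeasure_eq_measure)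
  from AE_not_in[OF this]
  have "AE z in m L. indicat_real (greedy_level n R L) z *\<^sub>R w (n - l) z = 0"
    by eventually_elim (auto simp: indicator_def)
  then have "(LINT z:greedy_level n R L|m L. w (n - l) z) = 0"
    unfolding set_lebesgue_integral_def by (rule integral_eq_zero_AE)
  then have "(\<Sum>i\<le>l. LINT z:greedy_level n R i|m i. g z) =
      (LINT z:R|m 0. g z) + (LINT z:R|m 0. u n z)"
    using sum_greedy_level[of l] Lle l by simp
  moreover have "0 < measure (m i) (greedy_level n R i)" if "i \<le> l" for i
    using below[of i] that l by (simp add: Q_def zero_less_measure_iff)
  ultimately show ?thesis using that[of l] Lle l by auto
qed

end

end

section \<open>Garsia's inequality for the recursion\<close>

text \<open>Garsia's argument: \<open>g = w (Suc n) - u n\<close> where \<open>w (Suc n) > 0\<close>, and \<open>\<integral>u n = \<integral>w n \<le> \<integral>w (Suc n)\<close>.\<close>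

lemma maximal_recursion_integral_nonneg:
  fixes g :: "'a \<Rightarrow> real" and w u :: "nat \<Rightarrow> 'a \<Rightarrow> real"
  assumes g: "integrable M g" and w: "\<And>n. integrable M (w n)" and u: "\<And>n. integrable M (u n)"
    and u_nonneg: "\<And>n z. 0 \<le> u n z" and u_w: "\<And>n. (LINT z|M. u n z) = (LINT z|M. w n z)"
    and w_0: "\<And>z. w 0 z = 0" and w_Suc: "\<And>n z. w (Suc n) z = max 0 (g z + u n z)"
    and w_mono: "\<And>n. AE z in M. w n z \<le> w (Suc n) z"
  shows "0 \<le> (LINT z:{z \<in> space M. \<exists>n. 0 < w n z}|M. g z)"
proof -
  have [measurable]: "g \<in> borel_measurable M" "\<And>n. w n \<in> borel_measurable M"
    using g w by auto
  define D where "D n = {z \<in> space M. 0 < w n z}" for n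
  define D' where "D' = {z \<in> space M. \<exists>n. 0 < w n z}"
  have D[measurable]: "D n \<in> sets M" "D' \<in> sets M" for n unfolding D_def D'_def by measurable
  have nonneg: "0 \<le> (LINT z:D n|M. g z)" for n
  proof (cases n)
    case 0
    then show ?thesis by (simp add: D_def w_0 set_lebesgue_integral_def)
  next
    case (Suc k)
    have "0 \<le> (LINT z|M. w n z) - (LINT z|M. u k z)"
      using u_w w w_mono[of k] Suc by (simp add: integral_mono_AE)
    also have "\<dots> = (LINT z|M. w n z - u k z)" using w u by simp
    also have "\<dots> \<le> (LINT z:D n|M. g z)"
      unfolding set_lebesgue_integral_def
    proof (rule integral_mono)
      fix z assume "z \<in> space M"
      \<comment> \<open>On \<open>D n\<close> both sides equal \<open>g z\<close>; off it
        \<open>w n z = 0\<close> and the left side is \<open>- u k z \<le> 0\<close>.\<close>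
      then show "w n z - u k z \<le> indicat_real (D n) z *\<^sub>R g z"
        using u_nonneg[of k z] by (auto simp: D_def Suc w_Suc indicator_def)
    qed (use w u g in \<open>auto intro!: integrable_mult_indicator simp del: real_scaleR_def\<close>)
    finally show ?thesis .
  qed
  \<comment> \<open>By \<open>w_mono\<close> the sets \<open>D n\<close> increase to
    \<open>D'\<close> off a null set, and the absolute value of g dominates.\<close>
  have "(\<lambda>n. LINT z:D n|M. g z) \<longlonglongrightarrow> (LINT z:D'|M. g z)"
    unfolding set_lebesgue_integral_def
  proof (rule integral_dominated_convergence)
    have "AE z in M. \<forall>n. w n z \<le> w (Suc n) z" using w_mono by (simp add: AE_all_countable)
    then show "AE z in M. (\<lambda>n. indicat_real (D n) z *\<^sub>R g z) \<longlonglongrightarrow> indicat_real D' z *\<^sub>R g z"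
      using AE_space
    proof eventually_elim
      case (elim z)
      show ?case
      proof (cases "z \<in> D'")
        case True
        then obtain n where n: "0 < w n z" by (auto simp: D'_def)
        have "indicat_real (D k) z *\<^sub>R g z = indicat_real D' z *\<^sub>R g z" if "n \<le> k" for k
          using lift_Suc_mono_le[of "\<lambda>n. w n z" n k] n that elim True by (auto simp: D_def)
        then show ?thesis by (intro tendsto_eventually eventually_sequentiallyI)
      next
        case False
        then have "z \<notin> D k" for k by (auto simp: D_def D'_def)
        then show ?thesis using False by simp
      qed
    qed
    show "integrable M (\<lambda>z. norm (g z))" using g by simp
  qed (auto simp: indicator_def)
  then show ?thesis
    unfolding D'_def by (rule LIMSEQ_le_const) (use nonneg in auto)
qed

section \<open>Identification of the level set and the maximal inequality\<close>

theorem theorem1p5: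
  fixes M :: "'a measure" and T :: "'a \<Rightarrow> 'a" and \<mu> :: "nat \<Rightarrow> 'a \<Rightarrow> 'a measure"
    and f :: "'a \<Rightarrow> real" and lam :: real
  assumes "standard_prob_space M"
    and "measure_preserving_map M T"
    and "\<And>x. x \<in> space M \<Longrightarrow> \<mu> 0 x = return M x"
    and "\<And>i. i \<ge> 1 \<Longrightarrow> disintegration M (T ^^ i) (\<mu> i)"
    and "integrable (completion M) f"
  shows "{x \<in> space M. tree_sup T \<mu> f x > ereal lam} \<in> sets (completion M) \<and>
    (LINT x:{x \<in> space M. tree_sup T \<mu> f x > ereal lam}|completion M. f x)
      \<ge> lam * measure (completion M) {x \<in> space M. tree_sup T \<mu> f x > ereal lam}"
proof -
  note std = assms(1)
  have P: "prob_space M" and B: "standard_borel M"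
    using std by (auto simp: standard_prob_space_def)
  interpret prob_space M by fact
  have T[measurable]: "T \<in> measurable M M" using assms(2) by (simp add: measure_preserving_map_def)
  have Tn: "T ^^ i \<in> measurable M M" for i
    by (induction i) (auto intro: measurable_comp[OF _ T])
  have D: "disintegration M (T ^^ i) (\<mu> i)" for i
  proof (cases "i = 0")
    case True
    then show ?thesis using disintegration_return[OF std assms(3)] by (simp add: id_def[symmetric])
  qed (use assms(4) in auto)
  have D1: "disintegration M T (\<mu> 1)" using D[of 1] by simp
  \<comment> \<open>The recursion needs a Borel function; \<open>f'\<close> agrees with f almost
    everywhere, also on almost every fibre by \<open>disintegration_AE\<close>.\<close>
  obtain f' where f'm[measurable]: "f' \<in> borel_measurable M" and ff': "AE x in M. f x = f' x"
    using completion_ex_borel_measurable_real[OF borel_measurable_integrable[OF assms(5)]]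
    by (elim bexE)
  have "integrable (completion M) f'"
    using integrable_cong_AE_imp[OF assms(5) measurable_completion[OF f'm]] ff'
    by (simp add: AE_completion_iff eq_commute)
  then have f': "integrable M f'" by (simp add: integrable_completion)
  define g where "g x = f' x - lam" for x
  have g: "integrable M g" unfolding g_def using f' by simp
  have gm[measurable]: "g \<in> borel_measurable M" using g by auto
  \<comment> \<open>The transfer is determined only almost everywhere; choosing one version for each
    h makes it a function that can be iterated.\<close>
  define U :: "('a \<Rightarrow> real) \<Rightarrow> 'a \<Rightarrow> real" where
    "U h = (SOME v. integrable M v \<and> (\<forall>z. 0 \<le> v z) \<and>
      (AE x in M. ennreal (v x) = (\<integral>\<^sup>+z. ennreal (h z) \<partial>\<mu> 1 x)) \<and>
      (LINT x|M. v x) = (LINT x|M. h x))" for h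
  have U: "integrable M (U h) \<and> (\<forall>z. 0 \<le> U h z) \<and>
      (AE x in M. ennreal (U h x) = (\<integral>\<^sup>+z. ennreal (h z) \<partial>\<mu> 1 x)) \<and>
      (LINT x|M. U h x) = (LINT x|M. h x)"
    if "integrable M h" "\<And>z. 0 \<le> h z" for h
    unfolding U_def by (rule someI_ex[OF disintegration_transfer[OF P D1 that]])
  define w where "w = rec_nat (\<lambda>_. 0) (\<lambda>_ h z. max 0 (g z + U h z))"
  define u where "u k = U (w k)" for k
  have w_0: "w 0 z = 0" and w_Suc: "w (Suc k) z = max 0 (g z + u k z)" for k z
    by (simp_all add: w_def u_def)
  have w_nonneg: "0 \<le> w k z" for k z by (cases k) (auto simp: w_0 w_Suc)
  have w: "integrable M (w k)" for k
  proof (induction k)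
    case 0
    show ?case by (simp add: w_0[abs_def])
  next
    case (Suc k)
    then show ?case using U[OF Suc w_nonneg] g by (simp add: w_Suc[abs_def] u_def)
  qed
  have u: "integrable M (u k)" "0 \<le> u k z" "(LINT z|M. u k z) = (LINT z|M. w k z)"
    "AE x in M. ennreal (u k x) = (\<integral>\<^sup>+z. ennreal (w k z) \<partial>\<mu> 1 x)" for k z
    using U[OF w w_nonneg, of k] by (auto simp: u_def)
  \<comment> \<open>Only almost everywhere, since each \<open>u k\<close> is just a version of the
    transfer of \<open>w k\<close>. The induction step is positivity of the transfer.\<close>
  have w_mono: "AE z in M. w k z \<le> w (Suc k) z" for k
  proof (induction k)
    case 0
    show ?case by (simp add: w_0 w_nonneg)
  next
    case (Suc k)
    show ?case using disintegration_AE[OF P D1 Suc] u(4)[of k] u(4)[of "Suc k"]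
    proof eventually_elim
      case (elim x)
      have "ennreal (u k x) \<le> ennreal (u (Suc k) x)"
        unfolding elim(2,3) by (rule nn_integral_mono_AE)
          (use elim(1) in eventually_elim, simp add: ennreal_leI)
      then show ?case using u(2)[of "Suc k" x] by (simp add: w_Suc[of k] w_Suc[of "Suc k"])
    qed
  qed
  have [measurable]: "w k \<in> borel_measurable M" for k using w[of k] by auto
  define A where "A = {x \<in> space M. tree_sup T \<mu> f x > ereal lam}"
  define A' where "A' = {x \<in> space M. \<exists>n. 0 < w n x}"
  have A'[measurable]: "A' \<in> sets M" unfolding A'_def by measurable
  \<comment> \<open>\<open>funpow_Suc_right\<close> splits \<open>T ^^ Suc i\<close> as
    \<open>T ^^ i \<circ> T\<close>: T is applied first, so fibres over T are glued along
    \<open>\<mu> i x\<close>.\<close>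
  have comp: "AE x in M. \<forall>E\<in>sets M.
      (LINT z:(T -` E \<inter> space M)|\<mu> (Suc i) x. w k z) = (LINT z:E|\<mu> i x. u k z)" for i k
    by (rule disintegration_comp_set_integral[OF std Tn T D D1
          D[of "Suc i", unfolded funpow_Suc_right] w w_nonneg u(1,2,4)])
  \<comment> \<open>Countably many almost sure statements in i and k are collected, the quantifier
    over E being already inside \<open>comp\<close>; at each remaining x the locale applies.\<close>
  have "AE x in M. \<forall>i. (AE z in \<mu> i x. f z = f' z) \<and> integrable (\<mu> i x) g \<and>
      (\<forall>k. integrable (\<mu> i x) (w k) \<and> integrable (\<mu> i x) (u k) \<and>
        (\<forall>E\<in>sets M. (LINT z:(T -` E \<inter> space M)|\<mu> (Suc i) x. w k z) = (LINT z:E|\<mu> i x. u k z)))"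
    unfolding AE_all_countable AE_conj_iff
    by (intro allI conjI comp disintegration_AE[OF P D ff'] disintegration_integrable[OF P D] g w u)
  then have AA': "AE x in M. x \<in> A \<longleftrightarrow> x \<in> A'"
    using AE_space
  proof eventually_elim
    case (elim x)
    note x = elim(2)
    note \<mu> = disintegration_sets[OF D x]
    interpret mu: prob_space "\<mu> i x" for i by (rule \<mu>)
    interpret tree_recursion M T "\<lambda>i. \<mu> i x" g w u
      by unfold_locales (use elim(1) \<mu>(1) T w_0 w_Suc in auto)
    have sx: "{x} \<in> sets M" by (rule standard_borel_singleton[OF B x])
    have root: "(LINT z:{x}|\<mu> 0 x. h z) = h x" if "h \<in> borel_measurable M" for h :: "'a \<Rightarrow> real"
    proof -
      have "(LINT z:{x}|\<mu> 0 x. h z) = (LINT z|return M x. indicat_real {x} z *\<^sub>R h z)"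
        using assms(3)[OF x] by (simp add: set_lebesgue_integral_def)
      also have "\<dots> = h x"
        using that sx x by (subst integral_return) auto
      finally show ?thesis .
    qed
    have root_mass: "measure (\<mu> 0 x) {x} = 1"
      using assms(3)[OF x] sx by (simp add: measure_return)
    \<comment> \<open>On each fibre \<open>f = g + lam\<close> almost everywhere, so the numerator
      is the sum for g plus lam times the mass, and the mass is positive.\<close>
    have average: "lam < tree_average \<mu> f x E \<longleftrightarrow> 0 < (\<Sum>i<length E. LINT z:E ! i|\<mu> i x. g z)"
      if E: "E \<in> coherent_trees T \<mu> x" for E
    proof -
      have Ei: "E ! i \<in> sets M" if "i < length E" for i
        using E that \<mu>(1) by (auto simp: coherent_trees_def)
      have mass: "0 < tree_mass \<mu> x E"
        unfolding tree_mass_def using E by (intro sum_pos) (auto simp: coherent_trees_def)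
      have "(LINT z:E ! i|completion (\<mu> i x). f z) =
          (LINT z:E ! i|\<mu> i x. g z) + lam * measure (\<mu> i x) (E ! i)" if i: "i < length E" for i
      proof -
        have s: "E ! i \<in> sets (\<mu> i x)" using Ei[OF i] by (simp add: \<mu>(1))
        have "(LINT z:E ! i|completion (\<mu> i x). f z) = (LINT z:E ! i|\<mu> i x. g z + lam)"
          using elim(1) s f'm \<mu>(1)
          by (intro set_integral_completion_AE) (simp_all add: g_def cong: measurable_cong_sets)
        also have "\<dots> = (LINT z:E ! i|\<mu> i x. g z) + (LINT z:E ! i|\<mu> i x. lam)"
          using set_int(1)[OF Ei[OF i]] s
          by (intro set_integral_add) (auto simp: set_integrable_def mu.emeasure_eq_measure)
        also have "(LINT z:E ! i|\<mu> i x. lam) = lam * measure (\<mu> i x) (E ! i)"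
          using s by (simp add: set_lebesgue_integral_def)
        finally show ?thesis .
      qed
      then have "(\<Sum>i<length E. LINT z:E ! i|completion (\<mu> i x). f z) =
          (\<Sum>i<length E. LINT z:E ! i|\<mu> i x. g z) + lam * tree_mass \<mu> x E"
        by (simp add: sum.distrib tree_mass_def sum_distrib_left)
      then show ?thesis
        using mass by (simp add: tree_average_def field_simps)
    qed
    have "x \<in> A \<longleftrightarrow> (\<exists>E\<in>coherent_trees T \<mu> x. lam < tree_average \<mu> f x E)"
      using x by (simp add: A_def tree_sup_def less_SUP_iff)
    also have "\<dots> \<longleftrightarrow> x \<in> A'"
    proof
      assume "\<exists>E\<in>coherent_trees T \<mu> x. lam < tree_average \<mu> f x E"
      then obtain E where E: "E \<in> coherent_trees T \<mu> x" "lam < tree_average \<mu> f x E" by blast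
      \<comment> \<open>A list of \<open>Suc n\<close> levels has n levels beyond the root, hence
        the bound by \<open>u n\<close> and the index \<open>Suc n\<close> for w.\<close>
      then obtain n where n: "length E = Suc n" by (cases "length E") (auto simp: coherent_trees_def)
      have E0: "E ! 0 = {x}" using E(1) by (simp add: coherent_trees_def)
      have "0 < (\<Sum>i\<le>n. LINT z:E ! i|\<mu> i x. g z)"
        using average[OF E(1)] E(2) n by (simp add: lessThan_Suc_atMost)
      also have "\<dots> \<le> (LINT z:E ! 0|\<mu> 0 x. g z) + (LINT z:E ! 0|\<mu> 0 x. u n z)"
        using E(1) n \<mu>(1) by (intro sum_tree_le) (auto simp: coherent_trees_def)
      also have "\<dots> = g x + u n x"
        using u(1)[of n] by (simp add: E0 root)
      finally show "x \<in> A'" using x by (auto simp: A'_def w_Suc intro!: exI[of _ "Suc n"])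
    next
      assume "x \<in> A'"
      then obtain k where "0 < w k x" by (auto simp: A'_def)
      \<comment> \<open>\<open>w 0 = 0\<close> rules out \<open>k = 0\<close>, and a positive
        maximum with 0 is attained by \<open>g x + u n x\<close>.\<close>
      then obtain n where n: "0 < g x + u n x" by (cases k) (auto simp: w_0 w_Suc max_def split: if_splits)
      obtain l where l: "\<And>i. i \<le> l \<Longrightarrow> 0 < measure (\<mu> i x) (greedy_level n {x} i)"
        "(\<Sum>i\<le>l. LINT z:greedy_level n {x} i|\<mu> i x. g z) =
          (LINT z:{x}|\<mu> 0 x. g z) + (LINT z:{x}|\<mu> 0 x. u n z)"
        using greedy_tree[of "{x}" n] sx root_mass by auto
      define E where "E = map (greedy_level n {x}) [0..<Suc l]"
      have E: "E ! i = greedy_level n {x} i" if "i \<le> l" for i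
        using that by (simp add: E_def nth_append del: upt_Suc)
      have len: "length E = Suc l" by (simp add: E_def)
      have "greedy_level n {x} i \<in> sets M" for i
        using sx by (intro greedy_level_sets) auto
      moreover have "measure (\<mu> (Suc i) x) (greedy_level n {x} (Suc i) - T -` greedy_level n {x} i) = 0"
        for i
      proof -
        have "greedy_level n {x} (Suc i) - T -` greedy_level n {x} i = {}" by auto
        then show ?thesis by (simp only: measure_empty)
      qed
      ultimately have "E \<in> coherent_trees T \<mu> x"
        using l(1) len E by (auto simp: coherent_trees_def \<mu>(1) less_Suc_eq_le simp del: greedy_level.simps(2))
      moreover have "0 < (\<Sum>i<length E. LINT z:E ! i|\<mu> i x. g z)"
        using l(2) n u(1)[of n] by (simp add: len lessThan_Suc_atMost E root)
      ultimately show "\<exists>E\<in>coherent_trees T \<mu> x. lam < tree_average \<mu> f x E"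
        using average by blast
    qed
    finally show ?case .
  qed
  \<comment> \<open>The supremum ranges over arbitrary Borel levels; A is measurable for the
    completion because it differs from the Borel set \<open>A'\<close> by a null set.\<close>
  have A: "A \<in> sets (completion M)"
  proof (rule completion.in_sets_AE)
    show "AE x in completion M. x \<in> A' \<longleftrightarrow> x \<in> A"
      unfolding AE_completion_iff using AA' by eventually_elim simp
  qed (use A' in \<open>auto simp: A_def\<close>)
  have "AE x in completion M. x \<in> A \<longleftrightarrow> x \<in> A'"
    unfolding AE_completion_iff by (rule AA')
  then have "measure (completion M) A = measure (completion M) A'"
    by (rule measure_eq_AE) (use A A' in simp_all)
  then have "lam * measure (completion M) A = lam * measure M A'"
    using A' by simp
  \<comment> \<open>The constant lam is written as \<open>f' - g\<close>, so that the inequality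
    reduces to nonnegativity of the integral of g over \<open>A'\<close>.\<close>
  also have "\<dots> = (LINT x:A'|M. f' x - g x)"
    by (simp add: g_def set_lebesgue_integral_def)
  also have "\<dots> = (LINT x:A'|M. f' x) - (LINT x:A'|M. g x)"
    using f' g by (intro set_integral_diff) (auto simp: set_integrable_def intro!: integrable_mult_indicator
        simp del: real_scaleR_def)
  also have "\<dots> \<le> (LINT x:A'|M. f' x)"
    using maximal_recursion_integral_nonneg[OF g w u(1,2,3) w_0 w_Suc w_mono] by (simp add: A'_def)
  also have "\<dots> = (LINT x:A|completion M. f x)"
    by (rule set_integral_completion_AE[OF ff' f'm A A' AA', symmetric])
  finally show ?thesis using A unfolding A_def by simp
qed

end
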